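(* Let $A,B,C$ be events in a probability space $(\Omega,\mathcal{F},P)$. The following statements are equivalent. (i) $A$ is independent of every $E\in\mathcal{P}_{B,C}$ (written $A\perp\!\!\!\perp[B,C]$). (ii) $A$ is independent of $B$, $A$ is independent of $C$, and $A$ is independent of $B\cup C$. (iii) $A$ is independent of $\sigma(B,C)$, that is, $A$ is independent of every $E\in\sigma(B,C)$.
   Context: Two events $A,E$ are independent if $P(A\cap E)=P(A)P(E)$. $\mathcal{P}_{B,C}$ denotes the partition of $\Omega$ induced by $B$ and $C$, i.e. the collection of the nonempty sets among $B\cap C$, $B^c\cap C$, $B\cap C^c$, $B^c\cap C^c$. $\sigma(B,C)$ denotes the $\sigma$-field on $\Omega$ generated by $\{B,C\}$. *)

theory Defs
  imports "HOL-Probability.Probability"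
begin

text \<open>Complements are taken in the sample space \<open>\<Omega>\<close>. Empty cells are discarded, so the
  collection may have fewer than four members.\<close>

definition induced_partition :: "'a set \<Rightarrow> 'a set \<Rightarrow> 'a set \<Rightarrow> 'a set set" where
  "induced_partition \<Omega> B C =
     {B \<inter> C, (\<Omega> - B) \<inter> C, B \<inter> (\<Omega> - C), (\<Omega> - B) \<inter> (\<Omega> - C)} - {{}}"

end

theory Submission
  imports Defs
begin

text \<open>The events independent of \<open>A\<close> form a Dynkin system. If it contains the cells, it contains
  their disjoint unions \<open>B\<close>, \<open>C\<close> and \<open>B \<union> C\<close>. If it contains these three, inclusion-exclusion gives
  \<open>B \<inter> C\<close> as well, hence the whole \<open>\<sigma>\<close>-field generated by the \<open>\<pi>\<close>-system \<open>{B, C, B \<inter> C}\<close>.\<close>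

context prob_space
begin

text \<open>\<open>indep_event\<close> is defined through a family of singletons indexed by
  \<open>bool\<close>. Recast as \<open>indep_set {A} {E}\<close>, it reduces to the product formula
  together with measurability of both events.\<close>

lemma indep_event_iff:
  "indep_event A E \<longleftrightarrow> A \<in> events \<and> E \<in> events \<and> prob (A \<inter> E) = prob A * prob E"
proof -
  have "(\<lambda>i. {case_bool A E i}) = case_bool {A} {E}"
    by (intro ext) (simp split: bool.split)
  then have "indep_event A E \<longleftrightarrow> indep_set {A} {E}"
    unfolding indep_event_def indep_events_def_alt indep_set_def by simp
  then show ?thesis
    by (simp add: indep_sets2_eq)
qed

lemma indep_event_empty:
  "A \<in> events \<Longrightarrow> indep_event A {}"
  by (simp add: indep_event_iff)

lemma indep_event_Un_disjoint:
  assumes "indep_event A E" "indep_event A F" "E \<inter> F = {}"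
  shows "indep_event A (E \<union> F)"
proof -
  have "prob ((A \<inter> E) \<union> (A \<inter> F)) = prob (A \<inter> E) + prob (A \<inter> F)"
    using assms by (intro finite_measure_Union) (auto simp: indep_event_iff)
  moreover have "prob (E \<union> F) = prob E + prob F"
    using assms by (intro finite_measure_Union) (auto simp: indep_event_iff)
  ultimately show ?thesis
    using assms by (auto simp: indep_event_iff Int_Un_distrib algebra_simps)
qed

lemma indep_event_Int:
  assumes "indep_event A B" "indep_event A C" "indep_event A (B \<union> C)"
  shows "indep_event A (B \<inter> C)"
proof -
  have sets: "A \<in> events" "B \<in> events" "C \<in> events"
    using assms by (auto simp: indep_event_iff)
  have incl_excl: "prob (E \<union> F) + prob (E \<inter> F) = prob E + prob F"
    if "E \<in> events" "F \<in> events" for E F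
    using that measure_Un3[of E M F] by (simp add: fmeasurable_eq_sets)
  \<comment> \<open>Inclusion-exclusion is used twice: here for the traces of \<open>B\<close> and
    \<open>C\<close> on \<open>A\<close>, and below for \<open>B\<close> and \<open>C\<close>
    themselves.\<close>
  have "prob (A \<inter> (B \<union> C)) + prob (A \<inter> (B \<inter> C)) = prob (A \<inter> B) + prob (A \<inter> C)"
    using incl_excl[of "A \<inter> B" "A \<inter> C"] sets by (simp add: Int_Un_distrib Int_ac)
  then have "prob (A \<inter> (B \<inter> C)) = prob A * (prob B + prob C - prob (B \<union> C))"
    using assms by (simp add: indep_event_iff algebra_simps)
  also have "\<dots> = prob A * prob (B \<inter> C)"
    \<comment> \<open>Comparing the products factor by factor avoids a case split on
      \<open>prob A = 0\<close>.\<close>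
    using incl_excl[of B C] sets by (intro arg_cong2[of _ _ _ _ "(*)"]) auto
  finally show ?thesis
    using sets by (simp add: indep_event_iff)
qed

text \<open>This is the Dynkin pi-lambda argument: independence of two intersection-stable families
  passes to the generated fields, and \<open>{A}\<close> is trivially intersection-stable.\<close>

lemma indep_event_sigma_sets:
  assumes "A \<in> events" "Int_stable G" "\<And>E. E \<in> G \<Longrightarrow> indep_event A E"
    and "E \<in> sigma_sets (space M) G"
  shows "indep_event A E"
proof -
  have "indep_set {A} G"
    using assms by (intro indep_setI) (auto simp: indep_event_iff)
  then have "indep_set (sigma_sets (space M) {A}) (sigma_sets (space M) G)"
    using assms(2) by (intro indep_set_sigma_sets) (auto simp: Int_stable_def)
  then show ?thesis
    using assms(1,4) by (auto simp: indep_event_iff indep_sets2_eq)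
qed

lemma indep_event_of_induced_partition:
  assumes "A \<in> events" "B \<subseteq> space M" "C \<subseteq> space M"
    and "\<forall>E \<in> induced_partition (space M) B C. indep_event A E"
  shows "indep_event A B" "indep_event A C" "indep_event A (B \<union> C)"
proof -
  \<comment> \<open>The assumption is silent about empty cells, which the partition discards; for
    those, independence is trivial.\<close>
  have cell: "indep_event A (B \<inter> C)" "indep_event A ((space M - B) \<inter> C)"
    "indep_event A (B \<inter> (space M - C))"
    using assms(4) indep_event_empty[OF assms(1)] unfolding induced_partition_def by auto
  have "indep_event A ((B \<inter> C) \<union> (B \<inter> (space M - C)))"
    by (intro indep_event_Un_disjoint cell) auto
  also have "(B \<inter> C) \<union> (B \<inter> (space M - C)) = B"
    using assms(2) by auto
  finally show B: "indep_event A B" .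
  have "indep_event A ((B \<inter> C) \<union> ((space M - B) \<inter> C))"
    by (intro indep_event_Un_disjoint cell) auto
  also have "(B \<inter> C) \<union> ((space M - B) \<inter> C) = C"
    using assms(3) by auto
  finally show "indep_event A C" .
  have "indep_event A (B \<union> ((space M - B) \<inter> C))"
    by (intro indep_event_Un_disjoint B cell) auto
  also have "B \<union> ((space M - B) \<inter> C) = B \<union> C"
    using assms(3) by auto
  finally show "indep_event A (B \<union> C)" .
qed

end

lemma induced_partition_subset_sigma_sets:
  assumes "B \<subseteq> \<Omega>" "C \<subseteq> \<Omega>"
  shows "induced_partition \<Omega> B C \<subseteq> sigma_sets \<Omega> {B, C}"
proof -
  interpret sigma_algebra \<Omega> "sigma_sets \<Omega> {B, C}"
    using assms by (intro sigma_algebra_sigma_sets) auto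
  show ?thesis
    unfolding induced_partition_def by auto
qed

theorem theorem4p5:
  fixes M :: "'a measure" and A B C :: "'a set"
  assumes "prob_space M"
    and "A \<in> sets M" and "B \<in> sets M" and "C \<in> sets M"
  shows "((\<forall>E \<in> induced_partition (space M) B C. prob_space.indep_event M A E) \<longleftrightarrow>
          (prob_space.indep_event M A B \<and> prob_space.indep_event M A C \<and>
           prob_space.indep_event M A (B \<union> C))) \<and>
         ((prob_space.indep_event M A B \<and> prob_space.indep_event M A C \<and>
           prob_space.indep_event M A (B \<union> C)) \<longleftrightarrow>
          (\<forall>E \<in> sigma_sets (space M) {B, C}. prob_space.indep_event M A E))"
    (is "(?i \<longleftrightarrow> ?ii) \<and> (?ii \<longleftrightarrow> ?iii)")
proof -
  interpret prob_space M by fact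
  have space: "B \<subseteq> space M" "C \<subseteq> space M"
    using assms(3,4) by (auto dest: sets.sets_into_space)
  have "?i \<Longrightarrow> ?ii"
    using indep_event_of_induced_partition[OF assms(2) space] by blast
  moreover have "?iii" if ?ii
  proof
    fix E assume "E \<in> sigma_sets (space M) {B, C}"
    \<comment> \<open>\<open>{B, C}\<close> need not be closed under intersection. Adding
      \<open>B \<inter> C\<close> to the generators makes it so, and keeps \<open>E\<close> in the
      generated field.\<close>
    then have E: "E \<in> sigma_sets (space M) {B, C, B \<inter> C}"
      using sigma_sets_mono'[of "{B, C}" "{B, C, B \<inter> C}"] by auto
    have "indep_event A F" if "F \<in> {B, C, B \<inter> C}" for F
      using that \<open>?ii\<close> indep_event_Int by blast
    moreover have "Int_stable {B, C, B \<inter> C}"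
      by (auto simp: Int_stable_def)
    ultimately show "indep_event A E"
      using indep_event_sigma_sets[OF assms(2) _ _ E] by blast
  qed
  \<comment> \<open>This closes the cycle of implications: each cell arises from \<open>B\<close>
    and \<open>C\<close> by complements and intersections, so it lies in the generated
    field.\<close>
  moreover have "?iii \<Longrightarrow> ?i"
    using induced_partition_subset_sigma_sets[OF space] by blast
  ultimately show ?thesis by blast
qed

end
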